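(* Let $\alpha\in(1,2)$ and let $(Y_i)_{i\ge1}$ be independent, identically distributed real random variables with distribution $$\mathbb{P}(Y\in dy)=\frac{\alpha}{2}\,\frac{dy}{|y|^{\alpha+1}}\,\mathbf{1}_{\{|y|>1\}}.$$ Then for all $0<p<\alpha$, $$\sup_{n\ge1}\ \mathbb{E}\left[\left|\frac{1}{n^{1/\alpha}}\sum_{i=1}^nY_i\right|^p\right]<+\infty.$$
   Context: Standing assumption of the paper: $\alpha\in(1,2)$. *)

theory Defs
  imports "HOL-Probability.Probability"
begin

definition sym_pareto_density :: "real \<Rightarrow> real \<Rightarrow> real" where
  "sym_pareto_density \<alpha> y =
     \<alpha> / 2 * (1 / \<bar>y\<bar> powr (\<alpha> + 1)) * indicator {y. \<bar>y\<bar> > 1} y"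

end

theory Submission
  imports Defs
begin

text \<open>
  Truncating each summand at level \<open>L\<close> gives centred bounded variables of variance
  \<open>O(L powr (2 - \<alpha>))\<close>, so Chebyshev's inequality for the truncated sum and a union bound for the
  summands exceeding \<open>L\<close> both contribute \<open>O(n L powr - \<alpha>)\<close> to the tail of the sum of \<open>n\<close> terms.
  With \<open>L = t n powr (1 / \<alpha>)\<close> the normalised sum has tail \<open>O(t powr - \<alpha>)\<close> uniformly in \<open>n\<close>, and
  summing over dyadic levels \<open>t\<close> bounds every moment of order \<open>p < \<alpha>\<close>.
\<close>

section \<open>Integrals against the symmetric Pareto density\<close>

lemma nn_integral_even_le:
  fixes h :: "real \<Rightarrow> ennreal"
  assumes [measurable]: "h \<in> borel_measurable borel" and even: "\<And>x. h (- x) = h x"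
  shows "(\<integral>\<^sup>+x. h x \<partial>lborel) \<le> 2 * (\<integral>\<^sup>+x. h x * indicator {0..} x \<partial>lborel)"
proof -
  have reflect: "(\<integral>\<^sup>+x. h x * indicator {..0} x \<partial>lborel) = (\<integral>\<^sup>+x. h x * indicator {0..} x \<partial>lborel)"
    by (subst nn_integral_real_affine[where c="-1" and t=0])
       (auto simp: even intro!: nn_integral_cong split: split_indicator)
  \<comment> \<open>Both half-lines contain the origin, so the pointwise comparison is only an
    inequality; all later uses are upper bounds.\<close>
  have "(\<integral>\<^sup>+x. h x \<partial>lborel)
      \<le> (\<integral>\<^sup>+x. h x * indicator {0..} x + h x * indicator {..0} x \<partial>lborel)"
    by (intro nn_integral_mono) (auto split: split_indicator)
  also have "\<dots> = 2 * (\<integral>\<^sup>+x. h x * indicator {0..} x \<partial>lborel)"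
    by (subst nn_integral_add) (auto simp: reflect mult_2)
  finally show ?thesis .
qed

lemma sym_pareto_density_measurable [measurable]:
  "sym_pareto_density \<alpha> \<in> borel_measurable borel"
  unfolding sym_pareto_density_def by measurable

lemma sym_pareto_density_minus: "sym_pareto_density \<alpha> (- y) = sym_pareto_density \<alpha> y"
  by (simp add: sym_pareto_density_def indicator_def)

lemma sym_pareto_density_nonneg: "0 \<le> \<alpha> \<Longrightarrow> 0 \<le> sym_pareto_density \<alpha> y"
  by (simp add: sym_pareto_density_def)

lemma sym_pareto_density_tail:
  assumes "0 < \<alpha>" and "1 \<le> L"
  shows "(\<integral>\<^sup>+y. ennreal (sym_pareto_density \<alpha> y) * indicator {y. L < \<bar>y\<bar>} y \<partial>lborel)
           \<le> ennreal (L powr - \<alpha>)"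
proof -
  have "(\<integral>\<^sup>+y. ennreal (sym_pareto_density \<alpha> y) * indicator {y. L < \<bar>y\<bar>} y \<partial>lborel)
      \<le> 2 * (\<integral>\<^sup>+y. ennreal (sym_pareto_density \<alpha> y) * indicator {y. L < \<bar>y\<bar>} y
               * indicator {0..} y \<partial>lborel)"
    by (rule nn_integral_even_le) (auto simp: sym_pareto_density_minus split: split_indicator)
  \<comment> \<open>Since \<open>1 \<le> L\<close>, every y > L lies in the support of the density,
    which there is the plain power. The half-line is closed at L to fit the fundamental theorem of
    calculus on \<open>{L..}\<close>.\<close>
  also have "\<dots> \<le> 2 * (\<integral>\<^sup>+y. ennreal (\<alpha> / 2 * y powr (- \<alpha> - 1)) * indicator {L..} y \<partial>lborel)"
    using assms
    by (intro mult_left_mono nn_integral_mono)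
       (auto simp: sym_pareto_density_def powr_diff powr_minus powr_add field_simps
             split: split_indicator)
  also have "(\<integral>\<^sup>+y. ennreal (\<alpha> / 2 * y powr (- \<alpha> - 1)) * indicator {L..} y \<partial>lborel)
      = ennreal (0 - (- (1 / 2) * L powr - \<alpha>))"
  proof (rule nn_integral_FTC_atLeast)
    fix y assume "L \<le> y"
    then show "((\<lambda>y. - (1 / 2) * y powr - \<alpha>) has_real_derivative \<alpha> / 2 * y powr (- \<alpha> - 1)) (at y)"
      using assms by (auto intro!: derivative_eq_intros simp: powr_diff field_simps)
  next
    have "((\<lambda>y. y powr - \<alpha>) \<longlongrightarrow> 0) at_top"
      using assms by (intro tendsto_neg_powr filterlim_ident) auto
    from tendsto_mult_left[OF this, of "- (1 / 2)"]
    show "((\<lambda>y. - (1 / 2) * y powr - \<alpha>) \<longlongrightarrow> 0) at_top"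
      by simp
  qed (use assms in auto)
  also have "2 * \<dots> = ennreal (L powr - \<alpha>)"
    by (simp flip: ennreal_numeral ennreal_mult)
  finally show ?thesis .
qed

text \<open>On y > 1 the integrand is a multiple of \<open>y powr (1 - \<alpha>)\<close>. As
  \<alpha> < 2, its antiderivative is a positive multiple of the increasing power
  \<open>y powr (2 - \<alpha>)\<close>, so the upper endpoint L governs the size.\<close>

lemma sym_pareto_density_truncated_second_moment:
  assumes "0 < \<alpha>" and "\<alpha> < 2" and "1 \<le> L"
  shows "(\<integral>\<^sup>+y. ennreal (sym_pareto_density \<alpha> y) * ennreal ((y * indicator {-L..L} y)\<^sup>2) \<partial>lborel)
           \<le> ennreal (\<alpha> / (2 - \<alpha>) * L powr (2 - \<alpha>))"
proof -
  let ?F = "\<lambda>y. \<alpha> / (2 * (2 - \<alpha>)) * y powr (2 - \<alpha>)"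
  have "(\<integral>\<^sup>+y. ennreal (sym_pareto_density \<alpha> y) * ennreal ((y * indicator {-L..L} y)\<^sup>2) \<partial>lborel)
      \<le> 2 * (\<integral>\<^sup>+y. ennreal (sym_pareto_density \<alpha> y) * ennreal ((y * indicator {-L..L} y)\<^sup>2)
               * indicator {0..} y \<partial>lborel)"
    by (rule nn_integral_even_le) (auto simp: sym_pareto_density_minus split: split_indicator)
  also have "\<dots> \<le> 2 * (\<integral>\<^sup>+y. ennreal (\<alpha> / 2 * y powr (1 - \<alpha>)) * indicator {1..L} y \<partial>lborel)"
  proof (intro mult_left_mono nn_integral_mono)
    \<comment> \<open>For y in [0,1] the density vanishes, which is why the integral can start at
      1.\<close>
    fix y :: real
    have "sym_pareto_density \<alpha> y * y\<^sup>2 = \<alpha> / 2 * y powr (1 - \<alpha>)" if "1 < y"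
      using that by (simp add: sym_pareto_density_def powr_diff powr_add power2_eq_square)
    then show "ennreal (sym_pareto_density \<alpha> y) * ennreal ((y * indicator {-L..L} y)\<^sup>2)
        * indicator {0..} y \<le> ennreal (\<alpha> / 2 * y powr (1 - \<alpha>)) * indicator {1..L} y"
      using assms
      by (auto simp: sym_pareto_density_nonneg simp flip: ennreal_mult split: split_indicator)
         (auto simp: sym_pareto_density_def split: split_indicator)
  qed simp
  also have "(\<integral>\<^sup>+y. ennreal (\<alpha> / 2 * y powr (1 - \<alpha>)) * indicator {1..L} y \<partial>lborel)
      = ennreal (?F L - ?F 1)"
  proof (rule nn_integral_FTC_Icc)
    fix y assume y: "y \<in> {1..L}"
    have "(?F has_real_derivative \<alpha> / (2 * (2 - \<alpha>)) * ((2 - \<alpha>) * y powr (2 - \<alpha> - 1))) (at y)"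
      using y by (intro DERIV_cmult has_real_derivative_powr) auto
    also have "\<alpha> / (2 * (2 - \<alpha>)) * ((2 - \<alpha>) * y powr (2 - \<alpha> - 1)) = \<alpha> / 2 * y powr (1 - \<alpha>)"
      using assms by (simp add: divide_simps)
    finally show "(?F has_real_derivative \<alpha> / 2 * y powr (1 - \<alpha>)) (at y)" .
  qed (use assms in auto)
  \<comment> \<open>The boundary term \<open>?F 1\<close> is nonnegative and is dropped.\<close>
  also have "2 * \<dots> \<le> 2 * ennreal (?F L)"
    using assms by (intro mult_left_mono ennreal_leI) auto
  also have "\<dots> = ennreal (2 * ?F L)"
    using ennreal_mult'[of 2 "?F L"] by simp
  also have "2 * ?F L = \<alpha> / (2 - \<alpha>) * L powr (2 - \<alpha>)"
    using assms by (simp add: field_simps)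
  finally show ?thesis .
qed

section \<open>Second moments and tails of sums of independent variables\<close>

lemma (in prob_space) second_moment_sum_indep_centered:
  fixes X :: "'i \<Rightarrow> 'a \<Rightarrow> real"
  assumes "finite I" and "indep_vars (\<lambda>_. borel) X I"
    and "\<And>i. i \<in> I \<Longrightarrow> integrable M (X i)"
    and "\<And>i. i \<in> I \<Longrightarrow> integrable M (\<lambda>\<omega>. (X i \<omega>)\<^sup>2)"
    and "\<And>i. i \<in> I \<Longrightarrow> expectation (X i) = 0"
  shows "integrable M (\<lambda>\<omega>. (\<Sum>i\<in>I. X i \<omega>)\<^sup>2) \<and>
         expectation (\<lambda>\<omega>. (\<Sum>i\<in>I. X i \<omega>)\<^sup>2) = (\<Sum>i\<in>I. expectation (\<lambda>\<omega>. (X i \<omega>)\<^sup>2))"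
  using assms
proof (induction I rule: finite_induct)
  case empty
  then show ?case by simp
next
  case (insert i I)
  let ?S = "\<lambda>\<omega>. \<Sum>i\<in>I. X i \<omega>"
  have "indep_vars (\<lambda>_. borel) X I"
    using insert.prems(1) by (rule indep_vars_subset) auto
  \<comment> \<open>Integrability is carried through the induction because additivity of the
    expectation in the expanded square depends on it.\<close>
  with insert have IH: "integrable M (\<lambda>\<omega>. (?S \<omega>)\<^sup>2)"
      "expectation (\<lambda>\<omega>. (?S \<omega>)\<^sup>2) = (\<Sum>i\<in>I. expectation (\<lambda>\<omega>. (X i \<omega>)\<^sup>2))"
    by auto
  have S: "integrable M ?S" "integrable M (X i)" "integrable M (\<lambda>\<omega>. (X i \<omega>)\<^sup>2)"
    using insert.prems by auto
  have indep: "indep_var borel (X i) borel ?S"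
    using insert by (intro indep_vars_sum) auto
  \<comment> \<open>By independence the expectation of the product factorises, and the factor coming
    from \<open>X i\<close> is zero.\<close>
  have cross: "integrable M (\<lambda>\<omega>. X i \<omega> * ?S \<omega>)" "expectation (\<lambda>\<omega>. X i \<omega> * ?S \<omega>) = 0"
    using indep_var_integrable[OF indep S(2,1)] indep_var_lebesgue_integral[OF indep S(2,1)]
      insert.prems(4)[of i] by auto
  have "(\<lambda>\<omega>. (\<Sum>j\<in>insert i I. X j \<omega>)\<^sup>2)
      = (\<lambda>\<omega>. (X i \<omega>)\<^sup>2 + 2 * (X i \<omega> * ?S \<omega>) + (?S \<omega>)\<^sup>2)"
    using insert.hyps by (auto simp: power2_eq_square algebra_simps)
  then show ?case
    using IH S cross insert.hyps by simp
qed

text \<open>Serves to pass between tail probabilities and integrals of a function of X, which can be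
  transferred to the density or summed over levels.\<close>

lemma (in prob_space) ennreal_prob_abs_gt:
  fixes X :: "'a \<Rightarrow> real"
  assumes [measurable]: "random_variable borel X"
  shows "ennreal (prob {\<omega> \<in> space M. t < \<bar>X \<omega>\<bar>}) = (\<integral>\<^sup>+\<omega>. indicator {x. t < \<bar>x\<bar>} (X \<omega>) \<partial>M)"
proof -
  have "(\<integral>\<^sup>+\<omega>. indicator {x. t < \<bar>x\<bar>} (X \<omega>) \<partial>M)
      = (\<integral>\<^sup>+\<omega>. indicator {\<omega> \<in> space M. t < \<bar>X \<omega>\<bar>} \<omega> \<partial>M)"
    by (intro nn_integral_cong) (simp split: split_indicator)
  then show ?thesis
    by (simp add: emeasure_eq_measure)
qed

text \<open>Each index contributes \<open>\<alpha> / (2 - \<alpha>)\<close> from Chebyshev's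
  inequality for the truncated sum and 1 from the union bound, both times
  \<open>L powr - \<alpha>\<close>; these constants add up to
  \<open>2 / (2 - \<alpha>)\<close>.\<close>

lemma (in prob_space) sym_pareto_sum_tail:
  assumes "0 < \<alpha>" and "\<alpha> < 2" and "1 \<le> L"
    and "finite I" and indep: "indep_vars (\<lambda>_. borel) Y I"
    and distr: "\<And>i. i \<in> I \<Longrightarrow> distributed M lborel (Y i) (\<lambda>y. ennreal (sym_pareto_density \<alpha> y))"
  shows "prob {\<omega> \<in> space M. L < \<bar>\<Sum>i\<in>I. Y i \<omega>\<bar>} \<le> 2 / (2 - \<alpha>) * real (card I) * L powr - \<alpha>"
proof -
  define Z where "Z = (\<lambda>i \<omega>. Y i \<omega> * indicator {-L..L} (Y i \<omega>))"
  have Y_meas [measurable]: "random_variable borel (Y i)" if "i \<in> I" for i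
    using indep that by (auto simp: indep_vars_def)
  have Z_meas [measurable]: "random_variable borel (Z i)" if "i \<in> I" for i
    using that unfolding Z_def by measurable
  have Z_le: "\<bar>Z i \<omega>\<bar> \<le> L" for i \<omega>
    using assms by (auto simp: Z_def split: split_indicator)
  have Z_int: "integrable M (Z i)" if "i \<in> I" for i
    using that Z_le by (intro integrable_const_bound[where B=L]) auto
  have Z_sq_int: "integrable M (\<lambda>\<omega>. (Z i \<omega>)\<^sup>2)" if "i \<in> I" for i
    using that power_mono[OF Z_le abs_ge_zero, of _ _ 2]
    by (intro integrable_const_bound[where B="L\<^sup>2"]) auto
  \<comment> \<open>The truncation interval is symmetric and the density even, so \<open>?f\<close>
    is odd; the substitution y to -y shows that its integral equals its own negative.\<close>
  have Z_mean: "expectation (Z i) = 0" if "i \<in> I" for i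
  proof -
    let ?f = "\<lambda>y. sym_pareto_density \<alpha> y * (y * indicator {-L..L} y)"
    have "expectation (Z i) = integral\<^sup>L lborel ?f"
      unfolding Z_def using assms
      by (intro distributed_integral[OF distr[OF that], symmetric])
         (auto simp: sym_pareto_density_nonneg)
    moreover have "integral\<^sup>L lborel ?f = (\<integral>y. ?f (- y) \<partial>lborel)"
      using lborel_integral_real_affine[of "-1" ?f 0] by simp
    moreover have "(\<lambda>y. ?f (- y)) = (\<lambda>y. - ?f y)"
      by (auto simp: sym_pareto_density_minus fun_eq_iff split: split_indicator)
    then have "(\<integral>y. ?f (- y) \<partial>lborel) = - integral\<^sup>L lborel ?f"
      by (simp only: Bochner_Integration.integral_minus)
    ultimately show ?thesis by linarith
  qed
  have Z_sq_mean: "expectation (\<lambda>\<omega>. (Z i \<omega>)\<^sup>2) \<le> \<alpha> / (2 - \<alpha>) * L powr (2 - \<alpha>)" if "i \<in> I" for i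
  proof -
    have "ennreal (expectation (\<lambda>\<omega>. (Z i \<omega>)\<^sup>2)) = (\<integral>\<^sup>+\<omega>. ennreal ((Z i \<omega>)\<^sup>2) \<partial>M)"
      using Z_sq_int[OF that] by (intro nn_integral_eq_integral[symmetric]) auto
    also have "\<dots> = (\<integral>\<^sup>+y. ennreal (sym_pareto_density \<alpha> y) * ennreal ((y * indicator {-L..L} y)\<^sup>2) \<partial>lborel)"
      unfolding Z_def by (intro distributed_nn_integral[OF distr[OF that], symmetric]) simp
    also have "\<dots> \<le> ennreal (\<alpha> / (2 - \<alpha>) * L powr (2 - \<alpha>))"
      using assms by (intro sym_pareto_density_truncated_second_moment)
    finally show ?thesis
      using assms by simp
  qed
  have Y_tail: "prob {\<omega> \<in> space M. L < \<bar>Y i \<omega>\<bar>} \<le> L powr - \<alpha>" if "i \<in> I" for i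
  proof -
    have "ennreal (prob {\<omega> \<in> space M. L < \<bar>Y i \<omega>\<bar>}) = (\<integral>\<^sup>+\<omega>. indicator {y. L < \<bar>y\<bar>} (Y i \<omega>) \<partial>M)"
      using that by (intro ennreal_prob_abs_gt Y_meas)
    also have "\<dots> = (\<integral>\<^sup>+y. ennreal (sym_pareto_density \<alpha> y) * indicator {y. L < \<bar>y\<bar>} y \<partial>lborel)"
      by (intro distributed_nn_integral[OF distr[OF that], symmetric]) simp
    also have "\<dots> \<le> ennreal (L powr - \<alpha>)"
      using assms by (intro sym_pareto_density_tail)
    finally show ?thesis by simp
  qed

  have Z_indep: "indep_vars (\<lambda>_. borel) Z I"
    unfolding Z_def by (rule indep_vars_compose2[OF indep]) simp
  have sum_sq: "integrable M (\<lambda>\<omega>. (\<Sum>i\<in>I. Z i \<omega>)\<^sup>2)"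
      "expectation (\<lambda>\<omega>. (\<Sum>i\<in>I. Z i \<omega>)\<^sup>2) = (\<Sum>i\<in>I. expectation (\<lambda>\<omega>. (Z i \<omega>)\<^sup>2))"
    using second_moment_sum_indep_centered[OF \<open>finite I\<close> Z_indep Z_int Z_sq_int Z_mean] by auto
  \<comment> \<open>The truncation level also serves as the Chebyshev threshold: dividing by the
    square of L turns \<open>L powr (2 - \<alpha>)\<close> into \<open>L powr - \<alpha>\<close>,
    the order of the union bound.\<close>
  have "prob {\<omega> \<in> space M. L \<le> \<bar>\<Sum>i\<in>I. Z i \<omega>\<bar>} \<le> expectation (\<lambda>\<omega>. (\<Sum>i\<in>I. Z i \<omega>)\<^sup>2) / L\<^sup>2"
    using assms sum_sq by (intro second_moment_method) auto
  also have "\<dots> \<le> (\<Sum>i\<in>I. \<alpha> / (2 - \<alpha>) * L powr (2 - \<alpha>)) / L\<^sup>2"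
    unfolding sum_sq by (intro divide_right_mono sum_mono Z_sq_mean) auto
  also have "\<dots> = \<alpha> / (2 - \<alpha>) * real (card I) * L powr - \<alpha>"
    using assms by (simp add: powr_diff powr_minus power2_eq_square field_simps)
  finally have Z_tail: "prob {\<omega> \<in> space M. L \<le> \<bar>\<Sum>i\<in>I. Z i \<omega>\<bar>}
      \<le> \<alpha> / (2 - \<alpha>) * real (card I) * L powr - \<alpha>" .

  have Z_event: "{\<omega> \<in> space M. L \<le> \<bar>\<Sum>i\<in>I. Z i \<omega>\<bar>} \<in> events"
    by measurable
  have Y_event: "{\<omega> \<in> space M. L < \<bar>Y i \<omega>\<bar>} \<in> events" if "i \<in> I" for i
    using that by measurable
  have Y_events: "(\<Union>i\<in>I. {\<omega> \<in> space M. L < \<bar>Y i \<omega>\<bar>}) \<in> events"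
    using \<open>finite I\<close> Y_event by (intro sets.finite_UN)
  \<comment> \<open>If no summand exceeds L in absolute value, truncation changes nothing and the
    two sums coincide.\<close>
  have "{\<omega> \<in> space M. L < \<bar>\<Sum>i\<in>I. Y i \<omega>\<bar>}
      \<subseteq> {\<omega> \<in> space M. L \<le> \<bar>\<Sum>i\<in>I. Z i \<omega>\<bar>} \<union> (\<Union>i\<in>I. {\<omega> \<in> space M. L < \<bar>Y i \<omega>\<bar>})"
  proof
    fix \<omega> assume \<omega>: "\<omega> \<in> {\<omega> \<in> space M. L < \<bar>\<Sum>i\<in>I. Y i \<omega>\<bar>}"
    show "\<omega> \<in> {\<omega> \<in> space M. L \<le> \<bar>\<Sum>i\<in>I. Z i \<omega>\<bar>} \<union> (\<Union>i\<in>I. {\<omega> \<in> space M. L < \<bar>Y i \<omega>\<bar>})"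
    proof (cases "\<exists>i\<in>I. L < \<bar>Y i \<omega>\<bar>")
      case False
      then have "(\<Sum>i\<in>I. Y i \<omega>) = (\<Sum>i\<in>I. Z i \<omega>)"
        by (intro sum.cong) (auto simp: Z_def split: split_indicator)
      with \<omega> show ?thesis by auto
    qed (use \<omega> in auto)
  qed
  then have "prob {\<omega> \<in> space M. L < \<bar>\<Sum>i\<in>I. Y i \<omega>\<bar>}
      \<le> prob ({\<omega> \<in> space M. L \<le> \<bar>\<Sum>i\<in>I. Z i \<omega>\<bar>} \<union> (\<Union>i\<in>I. {\<omega> \<in> space M. L < \<bar>Y i \<omega>\<bar>}))"
    using Z_event Y_events by (intro finite_measure_mono) auto
  also have "\<dots> \<le> prob {\<omega> \<in> space M. L \<le> \<bar>\<Sum>i\<in>I. Z i \<omega>\<bar>}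
      + prob (\<Union>i\<in>I. {\<omega> \<in> space M. L < \<bar>Y i \<omega>\<bar>})"
    using Z_event Y_events by (rule measure_Un_le)
  also have "prob (\<Union>i\<in>I. {\<omega> \<in> space M. L < \<bar>Y i \<omega>\<bar>}) \<le> (\<Sum>i\<in>I. L powr - \<alpha>)"
    using \<open>finite I\<close> Y_tail Y_event
    by (intro order.trans[OF finite_measure_subadditive_finite] sum_mono) auto
  also note Z_tail
  also have "\<alpha> / (2 - \<alpha>) * real (card I) * L powr - \<alpha> + (\<Sum>i\<in>I. L powr - \<alpha>)
      = 2 / (2 - \<alpha>) * real (card I) * L powr - \<alpha>"
    using assms by (simp add: field_simps)
  finally show ?thesis by simp
qed

section \<open>From tail bounds to moments\<close>

lemma powr_le_dyadic_sum:
  fixes x p :: real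
  assumes "0 \<le> p"
  shows "ennreal (\<bar>x\<bar> powr p)
           \<le> 1 + (\<Sum>k. ennreal (2 powr (p * (real k + 1))) * indicator {x. 2 ^ k < \<bar>x\<bar>} x)"
proof (cases "\<bar>x\<bar> \<le> 1")
  case True
  then have "\<bar>x\<bar> powr p \<le> 1"
    using assms by (intro powr_le1) auto
  then show ?thesis
    by (intro add_increasing2) (auto simp flip: ennreal_1 intro!: ennreal_leI)
next
  case False
  let ?f = "\<lambda>k. ennreal (2 powr (p * (real k + 1))) * indicator {x. 2 ^ k < \<bar>x\<bar>} x"
  \<comment> \<open>As |x| > 1, this n is positive. Its predecessor k satisfies 2^k < |x| \<le>
    2^(k+1) by minimality, so the k-th term of the series alone dominates
    \<open>\<bar>x\<bar> powr p\<close>.\<close>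
  define n where "n = (LEAST n. \<bar>x\<bar> \<le> 2 ^ n)"
  obtain m where "\<bar>x\<bar> \<le> 2 ^ m"
    using real_arch_pow[of 2 "\<bar>x\<bar>"] by (auto intro: less_imp_le)
  then have n: "\<bar>x\<bar> \<le> 2 ^ n"
    unfolding n_def by (rule LeastI)
  with False obtain k where k: "n = Suc k"
    by (cases n) auto
  then have "2 ^ k < \<bar>x\<bar>"
    using not_less_Least[of k "\<lambda>n. \<bar>x\<bar> \<le> 2 ^ n"] by (auto simp: n_def)
  moreover have "\<bar>x\<bar> powr p \<le> 2 powr (p * (real k + 1))"
  proof -
    have "\<bar>x\<bar> powr p \<le> (2 ^ n) powr p"
      using n assms by (intro powr_mono2) auto
    also have "\<dots> = 2 powr (p * (real k + 1))"
      by (simp add: powr_powr k mult.commute add.commute del: power_Suc flip: powr_realpow)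
    finally show ?thesis .
  qed
  ultimately have "ennreal (\<bar>x\<bar> powr p) \<le> ?f k"
    by (auto intro: ennreal_leI)
  also have "\<dots> \<le> (\<Sum>k. ?f k)"
    using sum_le_suminf[of ?f "{k}"] by (auto simp del: sum_mult_indicator)
  finally show ?thesis
    by (intro add_increasing) auto
qed

text \<open>Integrating the dyadic bound term by term, level k costs at most 2^(p(k+1)) times C
  2^(-\<alpha> k), a geometric series in k. The resulting bound depends on X only through C, which
  makes it uniform over a family sharing one tail bound.\<close>

lemma (in prob_space) moment_le_of_tail_bound:
  fixes X :: "'a \<Rightarrow> real"
  assumes [measurable]: "random_variable borel X"
    and p: "0 \<le> p" "p < \<alpha>" and "0 \<le> C"
    and tail: "\<And>t. 1 \<le> t \<Longrightarrow> prob {\<omega> \<in> space M. t < \<bar>X \<omega>\<bar>} \<le> C * t powr - \<alpha>"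
  shows "(\<integral>\<^sup>+\<omega>. ennreal (\<bar>X \<omega>\<bar> powr p) \<partial>M) \<le> ennreal (1 + C * 2 powr p / (1 - 2 powr (p - \<alpha>)))"
proof -
  let ?r = "2 powr (p - \<alpha>)"
  \<comment> \<open>Here p < \<alpha> enters: it puts the ratio of the geometric series below
    1.\<close>
  have r: "0 < ?r" "?r < 1"
    using p by (auto simp: powr_less_one)
  have "(\<integral>\<^sup>+\<omega>. ennreal (\<bar>X \<omega>\<bar> powr p) \<partial>M)
      \<le> (\<integral>\<^sup>+\<omega>. 1 + (\<Sum>k. ennreal (2 powr (p * (real k + 1))) * indicator {x. 2 ^ k < \<bar>x\<bar>} (X \<omega>)) \<partial>M)"
    using p by (intro nn_integral_mono powr_le_dyadic_sum)
  also have "\<dots> = 1 + (\<Sum>k. \<integral>\<^sup>+\<omega>. ennreal (2 powr (p * (real k + 1)))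
      * indicator {x. 2 ^ k < \<bar>x\<bar>} (X \<omega>) \<partial>M)"
    by (subst nn_integral_add) (auto simp: nn_integral_suminf emeasure_space_1)
  also have "\<dots> \<le> 1 + (\<Sum>k. ennreal (C * 2 powr p * ?r ^ k))"
  proof (intro add_left_mono suminf_le)
    fix k :: nat
    have "(\<integral>\<^sup>+\<omega>. ennreal (2 powr (p * (real k + 1))) * indicator {x. 2 ^ k < \<bar>x\<bar>} (X \<omega>) \<partial>M)
        = ennreal (2 powr (p * (real k + 1))) * (\<integral>\<^sup>+\<omega>. indicator {x. 2 ^ k < \<bar>x\<bar>} (X \<omega>) \<partial>M)"
      by (intro nn_integral_cmult) simp
    also have "(\<integral>\<^sup>+\<omega>. indicator {x. 2 ^ k < \<bar>x\<bar>} (X \<omega>) \<partial>M)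
        = ennreal (prob {\<omega> \<in> space M. 2 ^ k < \<bar>X \<omega>\<bar>})"
      by (intro ennreal_prob_abs_gt[symmetric]) simp
    also have "\<dots> \<le> ennreal (C * (2 ^ k) powr - \<alpha>)"
      by (intro ennreal_leI tail) simp
    also have "ennreal (2 powr (p * (real k + 1))) * \<dots>
        = ennreal (2 powr (p * (real k + 1)) * (C * (2 ^ k) powr - \<alpha>))"
      using \<open>0 \<le> C\<close> by (simp add: ennreal_mult)
    also have "2 powr (p * (real k + 1)) * (C * (2 ^ k) powr - \<alpha>) = C * 2 powr p * ?r ^ k"
      by (simp add: powr_powr powr_add powr_diff powr_minus field_simps
               flip: powr_realpow)
    finally show "(\<integral>\<^sup>+\<omega>. ennreal (2 powr (p * (real k + 1))) * indicator {x. 2 ^ k < \<bar>x\<bar>} (X \<omega>) \<partial>M)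
        \<le> ennreal (C * 2 powr p * ?r ^ k)"
      by (simp add: mult_left_mono)
  qed auto
  also have "(\<Sum>k. ennreal (C * 2 powr p * ?r ^ k)) = ennreal (C * 2 powr p * (1 / (1 - ?r)))"
    using r \<open>0 \<le> C\<close> by (intro suminf_ennreal_eq sums_mult geometric_sums) auto
  also have "1 + \<dots> = ennreal (1 + C * 2 powr p / (1 - ?r))"
    using r \<open>0 \<le> C\<close> by (simp flip: ennreal_1 ennreal_plus)
  finally show ?thesis .
qed

section \<open>Uniform moment bound for the normalised sums\<close>

theorem theorem7:
  fixes M :: "'a measure" and Y :: "nat \<Rightarrow> 'a \<Rightarrow> real" and \<alpha> p :: real
  assumes "prob_space M"
    and "1 < \<alpha>" and "\<alpha> < 2"
    and "prob_space.indep_vars M (\<lambda>_. borel) Y {1..}"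
    and "\<And>i. 1 \<le> i \<Longrightarrow> distributed M lborel (Y i) (\<lambda>y. ennreal (sym_pareto_density \<alpha> y))"
    and "0 < p" and "p < \<alpha>"
  shows "(SUP n\<in>{1::nat..}.
            \<integral>\<^sup>+ \<omega>. ennreal (\<bar>1 / real n powr (1 / \<alpha>) * (\<Sum>i = 1..n. Y i \<omega>)\<bar> powr p) \<partial>M) < \<infinity>"
proof -
  interpret prob_space M by fact
  \<comment> \<open>The bound of \<open>moment_le_of_tail_bound\<close> with C =
    \<open>2 / (2 - \<alpha>)\<close>, the constant of the sum's tail; it does not involve
    n.\<close>
  let ?B = "1 + 2 / (2 - \<alpha>) * 2 powr p / (1 - 2 powr (p - \<alpha>))"
  have "(\<integral>\<^sup>+ \<omega>. ennreal (\<bar>1 / real n powr (1 / \<alpha>) * (\<Sum>i = 1..n. Y i \<omega>)\<bar> powr p) \<partial>M) \<le> ennreal ?B"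
    if "1 \<le> n" for n
  proof (rule moment_le_of_tail_bound)
    have indep: "indep_vars (\<lambda>_. borel) Y {1..n}"
      using assms(4) by (rule indep_vars_subset) auto
    have [measurable]: "random_variable borel (Y i)" if "i \<in> {1..n}" for i
      using indep that by (auto simp: indep_vars_def)
    show "random_variable borel (\<lambda>\<omega>. 1 / real n powr (1 / \<alpha>) * (\<Sum>i = 1..n. Y i \<omega>))"
      by measurable
    fix t :: real assume t: "1 \<le> t"
    let ?L = "t * real n powr (1 / \<alpha>)"
    \<comment> \<open>Together with \<open>1 \<le> t\<close> this gives \<open>1 \<le> ?L\<close>,
      as the tail estimate for sums demands.\<close>
    have pos: "1 \<le> real n powr (1 / \<alpha>)"
      using that assms by (intro ge_one_powr_ge_zero) auto
    have "{\<omega> \<in> space M. t < \<bar>1 / real n powr (1 / \<alpha>) * (\<Sum>i = 1..n. Y i \<omega>)\<bar>}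
        = {\<omega> \<in> space M. ?L < \<bar>\<Sum>i = 1..n. Y i \<omega>\<bar>}"
      using that by (auto simp: abs_mult field_simps)
    also have "prob \<dots> \<le> 2 / (2 - \<alpha>) * real (card {1..n}) * ?L powr - \<alpha>"
      using assms t pos mult_mono[OF t pos] indep by (intro sym_pareto_sum_tail) auto
    \<comment> \<open>The scaling makes \<open>?L powr - \<alpha>\<close> equal to
      \<open>t powr - \<alpha>\<close> divided by n, cancelling the number of summands.\<close>
    also have "\<dots> = 2 / (2 - \<alpha>) * t powr - \<alpha>"
      using that t assms by (simp add: powr_mult powr_powr powr_minus field_simps)
    finally show "prob {\<omega> \<in> space M. t < \<bar>1 / real n powr (1 / \<alpha>) * (\<Sum>i = 1..n. Y i \<omega>)\<bar>}
        \<le> 2 / (2 - \<alpha>) * t powr - \<alpha>" .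
  qed (use assms in auto)
  then have "(SUP n\<in>{1::nat..}.
      \<integral>\<^sup>+ \<omega>. ennreal (\<bar>1 / real n powr (1 / \<alpha>) * (\<Sum>i = 1..n. Y i \<omega>)\<bar> powr p) \<partial>M) \<le> ennreal ?B"
    by (intro SUP_least) auto
  also have "\<dots> < \<infinity>" by simp
  finally show ?thesis .
qed

end
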